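(* Assume the Generalized Continuum Hypothesis. Let $U$ be an ultrafilter on a set $X$ and let $W$ be an ultrafilter on a set $Y$. Then $U\ltimes W = U\rtimes W$ if and only if $U\times W$ is an ultrafilter on $X\times Y$.
   Context: For filters $F$ on $X$ and $G$ on $Y$: - The Cartesian product $F\times G$ is the filter on $X\times Y$ generated by the sets $A\times B$ with $A\in F$, $B\in G$. - For $R\subseteq X\times Y$, write $(R)_x=\{y\in Y:(x,y)\in R\}$ and $(R)^y=\{x\in X:(x,y)\in R\}$. - The left tensor product is $F\ltimes G=\{R\subseteq X\times Y:\{x\in X:(R)_x\in G\}\in F\}$. - The right tensor product is $F\rtimes G=\{R\subseteq X\times Y:\{y\in Y:(R)^y\in F\}\in G\}$. *)

theory Defs
  imports "HOL-Library.Equipollence"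
begin

text \<open>
  A filter on a set \<open>X\<close> is represented by a library filter \<open>F\<close> with \<open>F \<le> principal X\<close>:
  the family of subsets of \<open>X\<close> is \<open>{A. A \<subseteq> X \<and> (\<forall>\<^sub>F x in F. x \<in> A)}\<close>, and this
  family determines \<open>F\<close>. The library admits the improper filter \<open>bot\<close>, which ultrafilters exclude.
  The Cartesian product of filters is the library's \<open>F \<times>\<^sub>F G\<close>.
\<close>

definition ultrafilter_on :: "'a set \<Rightarrow> 'a filter \<Rightarrow> bool" where
  "ultrafilter_on X U \<longleftrightarrow>
     U \<le> principal X \<and> U \<noteq> bot \<and>
     (\<forall>A\<subseteq>X. (\<forall>\<^sub>F x in U. x \<in> A) \<or> (\<forall>\<^sub>F x in U. x \<in> X - A))"

definition left_tensor :: "'a filter \<Rightarrow> 'b filter \<Rightarrow> ('a \<times> 'b) filter" where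
  "left_tensor F G = Abs_filter (\<lambda>P. \<forall>\<^sub>F x in F. \<forall>\<^sub>F y in G. P (x, y))"

definition right_tensor :: "'a filter \<Rightarrow> 'b filter \<Rightarrow> ('a \<times> 'b) filter" where
  "right_tensor F G = Abs_filter (\<lambda>P. \<forall>\<^sub>F y in G. \<forall>\<^sub>F x in F. P (x, y))"

lemma eventually_left_tensor:
  "eventually P (left_tensor F G) \<longleftrightarrow> (\<forall>\<^sub>F x in F. \<forall>\<^sub>F y in G. P (x, y))"
  unfolding left_tensor_def
  by (rule eventually_Abs_filter, rule is_filter.intro)
     (auto simp: eventually_conj_iff elim!: eventually_mono)

lemma eventually_right_tensor:
  "eventually P (right_tensor F G) \<longleftrightarrow> (\<forall>\<^sub>F y in G. \<forall>\<^sub>F x in F. P (x, y))"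
  unfolding right_tensor_def
  by (rule eventually_Abs_filter, rule is_filter.intro)
     (auto simp: eventually_conj_iff elim!: eventually_mono)

text \<open>The same in terms of the sections of a relation \<open>R \<subseteq> X \<times> Y\<close>.\<close>

lemma left_tensor_sections:
  assumes "F \<le> principal X" and "R \<subseteq> X \<times> Y"
  shows "(\<forall>\<^sub>F z in left_tensor F G. z \<in> R) \<longleftrightarrow>
    (\<forall>\<^sub>F x in F. x \<in> {x \<in> X. \<forall>\<^sub>F y in G. y \<in> {y \<in> Y. (x, y) \<in> R}})"
proof -
  have X: "\<forall>\<^sub>F x in F. x \<in> X"
    using assms(1) by (simp add: le_principal)
  have "{y \<in> Y. (x, y) \<in> R} = {y. (x, y) \<in> R}" for x
    using assms(2) by auto
  then show ?thesis
    using X by (simp add: eventually_left_tensor eventually_conj_iff)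
qed

lemma right_tensor_sections:
  assumes "G \<le> principal Y" and "R \<subseteq> X \<times> Y"
  shows "(\<forall>\<^sub>F z in right_tensor F G. z \<in> R) \<longleftrightarrow>
    (\<forall>\<^sub>F y in G. y \<in> {y \<in> Y. \<forall>\<^sub>F x in F. x \<in> {x \<in> X. (x, y) \<in> R}})"
proof -
  have Y: "\<forall>\<^sub>F y in G. y \<in> Y"
    using assms(1) by (simp add: le_principal)
  have "{x \<in> X. (x, y) \<in> R} = {x. (x, y) \<in> R}" for y
    using assms(2) by auto
  then show ?thesis
    using Y by (simp add: eventually_right_tensor eventually_conj_iff)
qed

text \<open>
  HOL cannot quantify over types inside a formula, so the Generalized Continuum Hypothesis is
  stated for the infinite sets of a given type: no cardinality lies strictly between that of \<open>A\<close>
  and that of its power set. It suffices to let the intermediate set \<open>B\<close> range over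
  \<open>'a set set\<close>, since every set of any type smaller than \<open>Pow A\<close> is equipollent to a subset
  of \<open>Pow A\<close>.
\<close>

definition GCH :: "'a itself \<Rightarrow> bool" where
  "GCH (_ :: 'a itself) \<longleftrightarrow>
     (\<forall>A :: 'a set. infinite A \<longrightarrow> (\<nexists>B :: 'a set set. A \<prec> B \<and> B \<prec> Pow A))"

end

theory Submission
  imports Defs
begin

text \<open>
  If \<open>R\<close> is not decided by \<open>U \<times> W\<close>, shrink to \<open>A \<in> U\<close> and \<open>B \<in> W\<close> on which the number \<open>\<kappa>\<close> of
  distinct rows and the number \<open>\<lambda>\<close> of distinct columns of \<open>R\<close> are both minimal. The quotients of
  \<open>U\<close> and \<open>W\<close> by equality of rows and columns are then uniform on \<open>\<kappa>\<close> and \<open>\<lambda>\<close>, both infinite.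
  By symmetry let \<open>\<kappa> \<le> \<lambda>\<close>; as \<open>\<lambda> \<le> 2\<^sup>\<kappa>\<close>, GCH leaves only \<open>\<lambda> = \<kappa>\<close> and \<open>\<lambda> = \<kappa>\<^sup>+\<close>. In both cases
  there are sets \<open>f y \<subseteq> \<kappa>\<close> of size less than \<open>\<kappa>\<close> such that every \<open>a < \<kappa>\<close> lies in \<open>f y\<close> for
  \<open>W\<close>-almost all \<open>y\<close>: for \<open>\<lambda> = \<kappa>\<close> take initial segments, for \<open>\<lambda> = \<kappa>\<^sup>+\<close> use injections of the
  ordinals below \<open>\<kappa>\<^sup>+\<close> into \<open>\<kappa>\<close>, as Kunen and Prikry did. The relation \<open>x \<in> f y\<close> is then in the
  left tensor product but, by uniformity of \<open>U\<close>, not in the right one.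
\<close>

unbundle cardinal_syntax

section \<open>Initial segments of a cardinal\<close>

abbreviation below :: "'a set \<Rightarrow> 'a \<Rightarrow> 'a set" where
  "below K \<equiv> underS (card_of K)"

abbreviation weak_below :: "'a set \<Rightarrow> 'a \<Rightarrow> 'a set" where
  "weak_below K \<equiv> under (card_of K)"

text \<open>An infinite cardinal has no last element, so a closed segment fits into an open one
  further up.\<close>

lemma card_of_under_ordLess:
  assumes "infinite K" and "a \<in> K"
  shows "|weak_below K a| <o |K|"
proof -
  obtain b where b: "b \<in> K" "a \<noteq> b" "(a, b) \<in> |K|"
    using infinite_Card_order_limit[OF card_of_Card_order[of K], of a] assms unfolding Field_card_of by blast
  have "trans |K|" "antisym |K|"
    using card_of_Well_order[of K] by (auto simp: order_on_defs)
  then have "weak_below K a \<subseteq> below K b"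
    using b unfolding under_def underS_def by (auto dest: transD antisymD)
  then have "|weak_below K a| \<le>o |below K b|" by (rule card_of_mono1)
  also have "|below K b| <o |K|"
    using card_of_underS[OF card_of_Card_order[of K], of b] b(1) unfolding Field_card_of by blast
  finally show ?thesis .
qed

lemma card_of_underS_ordLess:
  assumes "infinite K"
  shows "|below K a| <o |K|"
proof (cases "a \<in> K")
  case True
  then show ?thesis using card_of_underS[OF card_of_Card_order[of K], of a] unfolding Field_card_of by blast
next
  case False
  then have "below K a = {}"
    using Field_card_of[of K] by (auto simp: underS_def Field_def)
  moreover have "K \<noteq> {}" using assms by auto
  ultimately show ?thesis
    by (metis card_of_empty3 card_of_Well_order not_ordLess_iff_ordLeq)
qed

lemma mem_underS_or_under:
  assumes "a \<in> K" "b \<in> K"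
  shows "a \<in> below K b \<or> b \<in> weak_below K a"
proof -
  have "well_order_on K |K|" by (rule card_of_well_order_on)
  then have "total_on K |K|" "refl_on K |K|"
    by (auto simp: order_on_defs)
  then have "(a, b) \<in> |K| \<or> (b, a) \<in> |K|" and "(a, a) \<in> |K|"
    using assms unfolding total_on_def refl_on_def by metis+
  then show ?thesis unfolding under_def underS_def by auto
qed

section \<open>Uniform maps and covering families of small sets\<close>

text \<open>For an ultrafilter \<open>U\<close> this makes the image of \<open>U\<close> under
  \<open>p\<close> a uniform ultrafilter on \<open>K\<close>: it contains \<open>K\<close> and no
  set smaller than \<open>K\<close>.\<close>

definition uniform_on :: "'k set \<Rightarrow> 'a filter \<Rightarrow> ('a \<Rightarrow> 'k) \<Rightarrow> bool" where
  "uniform_on K U p \<longleftrightarrow> (\<forall>\<^sub>F x in U. p x \<in> K) \<and>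
     (\<forall>S. |S| <o |K| \<longrightarrow> (\<forall>\<^sub>F x in U. p x \<notin> S))"

lemma fine_if_unbounded:
  fixes K :: "'k set"
  assumes "infinite K" and gK: "\<forall>\<^sub>F y in W. g y \<in> K"
    and g: "\<And>c. c \<in> K \<Longrightarrow> \<forall>\<^sub>F y in W. g y \<notin> below K c"
  shows "\<exists>f :: 'b \<Rightarrow> 'k set. (\<forall>y. |f y| <o |K| ) \<and> (\<forall>a\<in>K. \<forall>\<^sub>F y in W. a \<in> f y)"
proof (intro exI conjI allI ballI)
  show "|below K (g y)| <o |K|" for y
    using assms(1) by (rule card_of_underS_ordLess)
  fix a assume a: "a \<in> K"
  \<comment> \<open>Going strictly above \<open>a\<close> matters: lying outside
    \<open>below K b\<close> only puts \<open>g y\<close> at or above \<open>b\<close>, while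
    \<open>a\<close> must be strictly below \<open>g y\<close>.\<close>
  obtain b where b: "b \<in> K" "a \<noteq> b" "(a, b) \<in> |K|"
    using infinite_Card_order_limit[OF card_of_Card_order[of K], of a] assms a unfolding Field_card_of by blast
  have "trans |K|" "antisym |K|"
    using card_of_Well_order[of K] by (auto simp: order_on_defs)
  show "\<forall>\<^sub>F y in W. a \<in> below K (g y)"
    using gK g[OF b(1)]
  proof eventually_elim
    case (elim y)
    then have "(b, g y) \<in> |K|"
      using mem_underS_or_under[OF elim(1) b(1)] by (auto simp: under_def)
    then show ?case
      using b \<open>trans |K|\<close> \<open>antisym |K|\<close> unfolding underS_def by (auto dest: transD antisymD)
  qed
qed

text \<open>The hypothesis \<open>suc\<close> bounds \<open>|L|\<close> by the successor of
  \<open>|K|\<close>. If \<open>|L| \<le>o |K|\<close>, an injection of \<open>L\<close> into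
  \<open>K\<close> yields an unbounded map; otherwise each proper initial segment of
  \<open>L\<close> is coded in \<open>K\<close>, and the codes provide the sets.\<close>

lemma fine_if_uniform:
  fixes K :: "'k set" and L :: "'l set" and W :: "'b filter"
  assumes K: "infinite K" and le: "|K| \<le>o |L|"
    and suc: "\<And>M :: 'l set. |M| <o |L| \<Longrightarrow> |M| \<le>o |K|"
    and ultra: "\<And>P. (\<forall>\<^sub>F y in W. P y) \<or> (\<forall>\<^sub>F y in W. \<not> P y)"
    and unif: "uniform_on L W q"
  shows "\<exists>f :: 'b \<Rightarrow> 'k set. (\<forall>y. |f y| <o |K| ) \<and> (\<forall>a\<in>K. \<forall>\<^sub>F y in W. a \<in> f y)"
proof (cases "|L| \<le>o |K|")
  case True
  then obtain h where h: "inj_on h L" "h ` L \<subseteq> K" by (auto simp flip: card_of_ordLeq)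
  show ?thesis
  proof (rule fine_if_unbounded[OF K])
    show qK: "\<forall>\<^sub>F y in W. (h \<circ> q) y \<in> K"
      using unif h(2) unfolding uniform_on_def by (auto elim!: eventually_mono)
    fix c
    \<comment> \<open>As \<open>h\<close> is injective, fewer than \<open>|K|\<close>, hence fewer
      than \<open>|L|\<close>, elements of \<open>L\<close> go below \<open>c\<close>, and
      uniformity of \<open>q\<close> avoids them.\<close>
    let ?S = "{z \<in> L. h z \<in> below K c}"
    have "|?S| \<le>o |below K c|"
      by (rule card_of_ordLeq[THEN iffD1]) (use h(1) in \<open>auto intro!: exI[of _ h] simp: inj_on_def\<close>)
    also have "|below K c| <o |K|" using K by (rule card_of_underS_ordLess)
    also note le
    finally have "\<forall>\<^sub>F y in W. q y \<notin> ?S" using unif unfolding uniform_on_def by blast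
    moreover have "\<forall>\<^sub>F y in W. q y \<in> L" using unif unfolding uniform_on_def by blast
    ultimately show "\<forall>\<^sub>F y in W. (h \<circ> q) y \<notin> below K c"
      by eventually_elim auto
  qed
next
  case False
  have L: "infinite L" using card_of_ordLeq_infinite[OF le K] .
  have qL: "\<forall>\<^sub>F y in W. q y \<in> L" using unif unfolding uniform_on_def by blast
  have above: "\<forall>\<^sub>F y in W. z \<in> below L (q y)" if z: "z \<in> L" for z
  proof -
    have "\<forall>\<^sub>F y in W. q y \<notin> weak_below L z"
      using unif card_of_under_ordLess[OF L z] unfolding uniform_on_def by blast
    with qL show ?thesis
      by eventually_elim (use mem_underS_or_under[OF z] in blast)
  qed
  have "\<exists>e. inj_on e (below L z) \<and> e ` below L z \<subseteq> K" for z
    using suc[OF card_of_underS_ordLess[OF L]] by (simp add: card_of_ordLeq)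
  then obtain e where inj: "\<And>z. inj_on (e z) (below L z)"
    and eK: "\<And>z. e z ` below L z \<subseteq> K" by metis
  show ?thesis
  \<comment> \<open>For fixed \<open>z\<close>, the code \<open>e (q y) z\<close> lies in
    \<open>K\<close> for almost all \<open>y\<close>, by \<open>above\<close>. If some
    \<open>z\<close> has unbounded codes, they serve as the map \<open>g\<close>; if not,
    \<open>ultra\<close> bounds the codes of each \<open>z\<close> by some
    \<open>c z\<close>.\<close>
  proof (cases "\<exists>z\<in>L. \<forall>c\<in>K. \<forall>\<^sub>F y in W. e (q y) z \<notin> below K c")
    case True
    then obtain z where z: "z \<in> L" "\<And>c. c \<in> K \<Longrightarrow> \<forall>\<^sub>F y in W. e (q y) z \<notin> below K c"
      by blast
    have "\<forall>\<^sub>F y in W. e (q y) z \<in> K"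
      using above[OF z(1)] by eventually_elim (use eK in blast)
    from fine_if_unbounded[OF K this z(2)] show ?thesis .
  next
    case neg: False
    have "\<exists>c\<in>K. \<forall>\<^sub>F y in W. e (q y) z \<in> below K c" if "z \<in> L" for z
      using neg that ultra[of "\<lambda>y. e (q y) z \<in> below K _"] by blast
    then obtain c where cK: "\<And>z. z \<in> L \<Longrightarrow> c z \<in> K"
      and c: "\<And>z. z \<in> L \<Longrightarrow> \<forall>\<^sub>F y in W. e (q y) z \<in> below K (c z)" by metis
    \<comment> \<open>Pigeonhole: if every fibre of \<open>c\<close> had size at most
      \<open>|K|\<close>, then so would their union \<open>L\<close>.\<close>
    have "\<exists>d\<in>K. |K| \<le>o |{z \<in> L. c z = d}|"
    proof (rule ccontr)
      assume "\<not> ?thesis"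
      then have "\<forall>d\<in>K. |{z \<in> L. c z = d}| \<le>o |K|"
        by (meson card_of_Well_order not_ordLeq_iff_ordLess ordLess_imp_ordLeq)
      then have "|\<Union>d\<in>K. {z \<in> L. c z = d}| \<le>o |K|"
        by (intro card_of_UNION_ordLeq_infinite[OF K]) (simp_all add: card_of_mono1)
      moreover have "(\<Union>d\<in>K. {z \<in> L. c z = d}) = L" using cK by auto
      ultimately show False using \<open>\<not> |L| \<le>o |K|\<close> by simp
    qed
    then obtain d i where i: "inj_on i K" "i ` K \<subseteq> {z \<in> L. c z = d}"
      by (auto simp flip: card_of_ordLeq)
    \<comment> \<open>\<open>i\<close> indexes by \<open>K\<close> elements of \<open>L\<close> with
      the common bound \<open>d\<close>. Distinct members of \<open>f y\<close> have distinct codes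
      below \<open>d\<close>, which keeps \<open>f y\<close> smaller than \<open>K\<close>.\<close>
    define f where "f y = {a \<in> K. i a \<in> below L (q y) \<and> e (q y) (i a) \<in> below K d}" for y
    have "|f y| <o |K|" for y
    proof -
      have "inj_on (\<lambda>a. e (q y) (i a)) (f y)"
        using inj[of "q y"] i(1) unfolding f_def inj_on_def by auto
      moreover have "(\<lambda>a. e (q y) (i a)) ` f y \<subseteq> below K d" unfolding f_def by auto
      ultimately have "|f y| \<le>o |below K d|" using card_of_ordLeq by blast
      also have "|below K d| <o |K|" using K by (rule card_of_underS_ordLess)
      finally show ?thesis .
    qed
    moreover have "\<forall>\<^sub>F y in W. a \<in> f y" if a: "a \<in> K" for a
    proof -
      have ia: "i a \<in> L" "c (i a) = d" using i(2) a by auto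
      from above[OF ia(1)] c[OF ia(1)] show ?thesis
        by eventually_elim (use a ia(2) in \<open>simp add: f_def\<close>)
    qed
    ultimately show ?thesis by blast
  qed
qed

section \<open>GCH as a bound on cardinals, and failure of commutation\<close>

lemma ordLess_imp_lesspoll:
  assumes "|A| <o |B|"
  shows "A \<prec> B"
proof -
  have "|A| \<le>o |B|" using assms by (rule ordLess_imp_ordLeq)
  then have "A \<lesssim> B" by (simp add: lepoll_def card_of_ordLeq)
  moreover have "\<not> A \<approx> B"
    unfolding eqpoll_iff_card_of_ordIso using not_ordLess_ordIso[OF assms] .
  ultimately show ?thesis by (simp add: lesspoll_def)
qed

text \<open>Otherwise \<open>M\<close> would lie strictly between \<open>A\<close> and
  \<open>Pow A\<close>. This is the source of the hypothesis \<open>suc\<close> above.\<close>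

lemma GCH_ordLeq:
  fixes A :: "'a set" and M L :: "'a set set"
  assumes "GCH TYPE('a)" and "infinite A" and "|M| <o |L|" and "|L| \<le>o |Pow A|"
  shows "|M| \<le>o |A|"
proof (rule ccontr)
  assume "\<not> |M| \<le>o |A|"
  then have "|A| <o |M|"
    using not_ordLeq_iff_ordLess[OF card_of_Well_order card_of_Well_order] by metis
  then have "A \<prec> M"
    by (rule ordLess_imp_lesspoll)
  moreover from assms(3,4) have "|M| <o |Pow A|" by (rule ordLess_ordLeq_trans)
  then have "M \<prec> Pow A"
    by (rule ordLess_imp_lesspoll)
  ultimately show False using assms(1,2) unfolding GCH_def by blast
qed

lemma not_commute_if_uniform:
  fixes K :: "'k set" and L :: "'l set"
  assumes "U \<noteq> bot" and "W \<noteq> bot" and K: "infinite K" and le: "|K| \<le>o |L|"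
    and suc: "\<And>M :: 'l set. |M| <o |L| \<Longrightarrow> |M| \<le>o |K|"
    and ultra: "\<And>P. (\<forall>\<^sub>F y in W. P y) \<or> (\<forall>\<^sub>F y in W. \<not> P y)"
    and p: "uniform_on K U p" and q: "uniform_on L W q"
  shows "\<exists>P. (\<forall>\<^sub>F x in U. \<forall>\<^sub>F y in W. P x y) \<and> \<not> (\<forall>\<^sub>F y in W. \<forall>\<^sub>F x in U. P x y)"
proof -
  obtain f where small: "\<And>y. |f y| <o |K|" and fine: "\<And>a. a \<in> K \<Longrightarrow> \<forall>\<^sub>F y in W. a \<in> f y"
    using fine_if_uniform[OF K le suc ultra q] by blast
  have "\<forall>\<^sub>F x in U. \<forall>\<^sub>F y in W. p x \<in> f y"
    using p fine unfolding uniform_on_def by (auto elim: eventually_mono)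
  moreover have "\<not> (\<forall>\<^sub>F y in W. \<forall>\<^sub>F x in U. p x \<in> f y)"
  proof
    assume "\<forall>\<^sub>F y in W. \<forall>\<^sub>F x in U. p x \<in> f y"
    then obtain y where "\<forall>\<^sub>F x in U. p x \<in> f y"
      using \<open>W \<noteq> bot\<close> eventually_happens' by blast
    moreover have "\<forall>\<^sub>F x in U. p x \<notin> f y" using p small unfolding uniform_on_def by blast
    ultimately have "\<forall>\<^sub>F x in U. False" by eventually_elim simp
    then show False using \<open>U \<noteq> bot\<close> by (simp add: eventually_False)
  qed
  ultimately show ?thesis by (rule_tac exI[of _ "\<lambda>x y. p x \<in> f y"]) blast
qed

section \<open>Counting rows and columns of a relation\<close>

text \<open>Cutting down to \<open>B\<close> identifies points whose rows differ only outside
  \<open>B\<close>. Columns are the rows of the transposed relation.\<close>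

definition row :: "('a \<Rightarrow> 'b \<Rightarrow> bool) \<Rightarrow> 'b set \<Rightarrow> 'a \<Rightarrow> 'b set" where
  "row R B x = {y \<in> B. R x y}"

text \<open>Rows over \<open>B'\<close> are traces of rows over \<open>B\<close>. Hence a minimal
  number of rows stays minimal when the two sets shrink further within the filters.\<close>

lemma row_image_mono:
  assumes "A' \<subseteq> A" and "B' \<subseteq> B"
  shows "|row R B' ` A'| \<le>o |row R B ` A|"
proof -
  have "row R B' x = row R B x \<inter> B'" for x
    using assms(2) unfolding row_def by auto
  then have "row R B' ` A' = (\<lambda>S. S \<inter> B') ` row R B ` A'"
    by (simp add: image_image)
  then have "|row R B' ` A'| \<le>o |row R B ` A'|" by (simp only: card_of_image)
  also have "|row R B ` A'| \<le>o |row R B ` A|"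
    using assms(1) by (intro card_of_mono1 image_mono)
  finally show ?thesis .
qed

lemma minimal_rows:
  fixes R :: "'a \<Rightarrow> 'b \<Rightarrow> bool"
  obtains A B where "\<forall>\<^sub>F x in U. x \<in> A" "\<forall>\<^sub>F y in W. y \<in> B"
    "\<And>A' B'. \<forall>\<^sub>F x in U. x \<in> A' \<Longrightarrow> \<forall>\<^sub>F y in W. y \<in> B' \<Longrightarrow> |row R B ` A| \<le>o |row R B' ` A'|"
proof -
  let ?C = "(\<lambda>(A, B). |row R B ` A| ) ` ({A. \<forall>\<^sub>F x in U. x \<in> A} \<times> {B. \<forall>\<^sub>F y in W. y \<in> B})"
  have "UNIV \<in> {A. \<forall>\<^sub>F x in U. x \<in> A}" "UNIV \<in> {B. \<forall>\<^sub>F y in W. y \<in> B}" by simp_all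
  then have "?C \<noteq> {}" by blast
  then have "\<exists>r\<in>?C. \<forall>r'\<in>?C. r \<le>o r'"
    by (rule exists_minim_Card_order) (auto simp: card_of_Card_order)
  then obtain r where "r \<in> ?C" and min: "\<forall>r'\<in>?C. r \<le>o r'" by (elim bexE)
  from this(1) obtain A B where AB: "r = |row R B ` A|"
    "\<forall>\<^sub>F x in U. x \<in> A" "\<forall>\<^sub>F y in W. y \<in> B" by clarsimp
  show ?thesis
  proof (rule that[OF AB(2,3)])
    fix A' B' assume "\<forall>\<^sub>F x in U. x \<in> A'" "\<forall>\<^sub>F y in W. y \<in> B'"
    then show "|row R B ` A| \<le>o |row R B' ` A'|"
      using min AB(1) by auto
  qed
qed

text \<open>If a smaller set \<open>S\<close> of rows caught almost all points, the points with row
  in \<open>S\<close> would contradict minimality.\<close>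

lemma uniform_on_rows:
  assumes ultra: "\<And>P. (\<forall>\<^sub>F x in U. P x) \<or> (\<forall>\<^sub>F x in U. \<not> P x)"
    and A: "\<forall>\<^sub>F x in U. x \<in> A"
    and min: "\<And>A'. \<forall>\<^sub>F x in U. x \<in> A' \<Longrightarrow> |row R B ` A| \<le>o |row R B ` A'|"
  shows "uniform_on (row R B ` A) U (row R B)"
  unfolding uniform_on_def
proof (intro conjI allI impI)
  show "\<forall>\<^sub>F x in U. row R B x \<in> row R B ` A"
    using A by eventually_elim simp
  fix S :: "'b set set"
  assume S: "|S| <o |row R B ` A|"
  show "\<forall>\<^sub>F x in U. row R B x \<notin> S"
  proof (rule ccontr)
    assume "\<not> ?thesis"
    then have "\<forall>\<^sub>F x in U. x \<in> {x. row R B x \<in> S}" using ultra by auto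
    from min[OF this] have "|row R B ` A| \<le>o |row R B ` {x. row R B x \<in> S}|" .
    also have "|row R B ` {x. row R B x \<in> S}| \<le>o |S|" by (rule card_of_mono1) auto
    finally show False using S not_ordLess_ordLeq by blast
  qed
qed

text \<open>Columns are determined by their traces on a set of representatives of the rows, so there
  are at most 2 to the number of rows many of them, and GCH applies to that set.\<close>

lemma GCH_columns:
  fixes R :: "'a \<Rightarrow> 'b \<Rightarrow> bool" and M :: "'a set set"
  assumes "GCH TYPE('a)" and inf: "infinite (row R B ` A)"
    and M: "|M| <o |row (\<lambda>y x. R x y) A ` B|"
  shows "|M| \<le>o |row R B ` A|"
proof -
  obtain K where K: "K \<subseteq> A" "inj_on (row R B) K" "row R B ` K = row R B ` A"
    using subset_image_inj[of "row R B ` A" "row R B" A] by auto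
  let ?L = "row (\<lambda>y x. R x y) A ` B"
  have "inj_on (\<lambda>S. S \<inter> K) ?L"
  proof (rule inj_onI, clarify)
    fix y y' assume y: "y \<in> B" "y' \<in> B"
      and eq: "row (\<lambda>y x. R x y) A y \<inter> K = row (\<lambda>y x. R x y) A y' \<inter> K"
    \<comment> \<open>Each \<open>x\<close> in \<open>A\<close> has the same row as some
      representative \<open>k\<close>, where the two columns agree.\<close>
    have "R x y \<longleftrightarrow> R x y'" if "x \<in> A" for x
    proof -
      have "row R B x \<in> row R B ` K" using that K(3) by simp
      then obtain k where k: "k \<in> K" "row R B x = row R B k" by blast
      then have "R k y \<longleftrightarrow> R k y'" using eq K(1) unfolding row_def by blast
      then show ?thesis using k(2) y unfolding row_def by blast
    qed
    then show "row (\<lambda>y x. R x y) A y = row (\<lambda>y x. R x y) A y'" unfolding row_def by auto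
  qed
  moreover have "(\<lambda>S. S \<inter> K) ` ?L \<subseteq> Pow K" by auto
  ultimately have L: "|?L| \<le>o |Pow K|"
    by (rule card_of_ordLeq[THEN iffD1, OF exI, OF conjI])
  have "infinite K" using inf K(3) by (metis finite_imageI)
  from GCH_ordLeq[OF assms(1) this M L] have "|M| \<le>o |K|" .
  also have "|K| \<le>o |row R B ` A|"
    by (rule card_of_ordLeq[THEN iffD1, OF exI, OF conjI, OF K(2)]) (simp add: K(3))
  finally show ?thesis .
qed

text \<open>An ultrafilter concentrates on one of finitely many rows, say \<open>S\<close>. On the
  resulting rectangle \<open>R x y\<close> depends only on whether \<open>y\<close> is in
  \<open>S\<close>, which \<open>W\<close> decides.\<close>

lemma decided_if_finite_rows:
  assumes ultraU: "\<And>P. (\<forall>\<^sub>F x in U. P x) \<or> (\<forall>\<^sub>F x in U. \<not> P x)"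
    and ultraW: "\<And>P. (\<forall>\<^sub>F y in W. P y) \<or> (\<forall>\<^sub>F y in W. \<not> P y)"
    and "U \<noteq> bot" and A: "\<forall>\<^sub>F x in U. x \<in> A" and B: "\<forall>\<^sub>F y in W. y \<in> B"
    and fin: "finite (row R B ` A)"
  shows "(\<forall>\<^sub>F (x, y) in U \<times>\<^sub>F W. R x y) \<or> (\<forall>\<^sub>F (x, y) in U \<times>\<^sub>F W. \<not> R x y)"
proof -
  have "\<exists>S\<in>row R B ` A. \<forall>\<^sub>F x in U. row R B x = S"
  proof (rule ccontr)
    assume neg: "\<not> ?thesis"
    have "\<forall>\<^sub>F x in U. \<forall>S\<in>row R B ` A. row R B x \<noteq> S"
    proof (intro eventually_ball_finite[OF fin] ballI)
      fix S assume "S \<in> row R B ` A"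
      with neg have "\<not> (\<forall>\<^sub>F x in U. row R B x = S)" by blast
      then show "\<forall>\<^sub>F x in U. row R B x \<noteq> S"
        using ultraU[of "\<lambda>x. row R B x = S"] by simp
    qed
    with A have "\<forall>\<^sub>F x in U. False" by eventually_elim auto
    then show False using \<open>U \<noteq> bot\<close> by (simp add: eventually_False)
  qed
  then obtain S where S: "\<forall>\<^sub>F x in U. row R B x = S" by blast
  have mem: "R (fst z) (snd z) \<longleftrightarrow> snd z \<in> S"
    if "row R B (fst z) = S \<and> snd z \<in> B" for z
    using that unfolding row_def by blast
  have rect: "\<forall>\<^sub>F z in U \<times>\<^sub>F W. row R B (fst z) = S \<and> snd z \<in> B"
    using S B by (rule eventually_prodI)
  show ?thesis
    using ultraW[of "\<lambda>y. y \<in> S"]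
  proof
    assume "\<forall>\<^sub>F y in W. y \<in> S"
    with eventually_True have "\<forall>\<^sub>F z in U \<times>\<^sub>F W. True \<and> snd z \<in> S"
      by (rule eventually_prodI)
    with rect have "\<forall>\<^sub>F z in U \<times>\<^sub>F W. R (fst z) (snd z)"
      by eventually_elim (simp only: mem)
    then show ?thesis by (simp add: case_prod_unfold)
  next
    assume "\<forall>\<^sub>F y in W. y \<notin> S"
    with eventually_True have "\<forall>\<^sub>F z in U \<times>\<^sub>F W. True \<and> snd z \<notin> S"
      by (rule eventually_prodI)
    with rect have "\<forall>\<^sub>F z in U \<times>\<^sub>F W. \<not> R (fst z) (snd z)"
      by eventually_elim (simp only: mem simp_thms)
    then show ?thesis by (simp add: case_prod_unfold)
  qed
qed

section \<open>Commuting ultrafilters decide every relation\<close>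

lemma prod_filter_decides_if_commute:
  fixes U :: "'a filter" and W :: "'b filter" and R :: "'a \<Rightarrow> 'b \<Rightarrow> bool"
  assumes gch: "GCH TYPE('a)" "GCH TYPE('b)"
    and ultraU: "\<And>P. (\<forall>\<^sub>F x in U. P x) \<or> (\<forall>\<^sub>F x in U. \<not> P x)"
    and ultraW: "\<And>P. (\<forall>\<^sub>F y in W. P y) \<or> (\<forall>\<^sub>F y in W. \<not> P y)"
    and bot: "U \<noteq> bot" "W \<noteq> bot"
    and comm: "\<And>P. (\<forall>\<^sub>F x in U. \<forall>\<^sub>F y in W. P x y) \<longleftrightarrow> (\<forall>\<^sub>F y in W. \<forall>\<^sub>F x in U. P x y)"
  shows "(\<forall>\<^sub>F (x, y) in U \<times>\<^sub>F W. R x y) \<or> (\<forall>\<^sub>F (x, y) in U \<times>\<^sub>F W. \<not> R x y)"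
proof (rule ccontr)
  assume undecided: "\<not> ?thesis"
  let ?R' = "\<lambda>y x. R x y"
  obtain A1 B1 where 1: "\<forall>\<^sub>F x in U. x \<in> A1" "\<forall>\<^sub>F y in W. y \<in> B1"
    "\<And>A' B'. \<forall>\<^sub>F x in U. x \<in> A' \<Longrightarrow> \<forall>\<^sub>F y in W. y \<in> B' \<Longrightarrow> |row R B1 ` A1| \<le>o |row R B' ` A'|"
    using minimal_rows by blast
  obtain A2 B2 where 2: "\<forall>\<^sub>F y in W. y \<in> B2" "\<forall>\<^sub>F x in U. x \<in> A2"
    "\<And>B' A'. \<forall>\<^sub>F y in W. y \<in> B' \<Longrightarrow> \<forall>\<^sub>F x in U. x \<in> A' \<Longrightarrow> |row ?R' A2 ` B2| \<le>o |row ?R' A' ` B'|"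
    using minimal_rows by blast
  \<comment> \<open>Rows and columns were minimized separately; by \<open>row_image_mono\<close> the
    intersections are minimal for both.\<close>
  define A B where "A = A1 \<inter> A2" and "B = B1 \<inter> B2"
  have A: "\<forall>\<^sub>F x in U. x \<in> A" and B: "\<forall>\<^sub>F y in W. y \<in> B"
    using 1 2 by (auto simp: A_def B_def eventually_conj_iff)
  define K L where "K = row R B ` A" and "L = row ?R' A ` B"
  have uK: "uniform_on K U (row R B)" unfolding K_def
  proof (rule uniform_on_rows[OF ultraU A])
    fix A' assume "\<forall>\<^sub>F x in U. x \<in> A'"
    from 1(3)[OF this B] show "|row R B ` A| \<le>o |row R B ` A'|"
      using row_image_mono[of A A1 B B1] ordLeq_transitive by (auto simp: A_def B_def)
  qed
  have uL: "uniform_on L W (row ?R' A)" unfolding L_def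
  proof (rule uniform_on_rows[OF ultraW B])
    fix B' assume "\<forall>\<^sub>F y in W. y \<in> B'"
    from 2(3)[OF this A] show "|row ?R' A ` B| \<le>o |row ?R' A ` B'|"
      using row_image_mono[of B B2 A A2] ordLeq_transitive by (auto simp: A_def B_def)
  qed
  have infK: "infinite K"
    using decided_if_finite_rows[OF ultraU ultraW bot(1) A B] undecided K_def by blast
  have infL: "infinite L"
  proof
    \<comment> \<open>The finite case applies to the transposed relation, and swapping the product
      filter carries the decision back to \<open>R\<close>.\<close>
    assume "finite L"
    then have "(\<forall>\<^sub>F (y, x) in W \<times>\<^sub>F U. R x y) \<or> (\<forall>\<^sub>F (y, x) in W \<times>\<^sub>F U. \<not> R x y)"
      using decided_if_finite_rows[OF ultraW ultraU bot(2) B A] L_def by blast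
    then show False
      using undecided by (simp add: prod_filter_commute[of W U] eventually_filtermap case_prod_unfold)
  qed
  consider "|K| \<le>o |L|" | "|L| \<le>o |K|"
    using ordLeq_total[OF card_of_Well_order card_of_Well_order] by metis
  then show False
  proof cases
    case 1
    have "|M| \<le>o |K|" if "|M| <o |L|" for M :: "'a set set"
      using GCH_columns[OF gch(1) infK[unfolded K_def]] that unfolding K_def L_def by simp
    from not_commute_if_uniform[OF bot infK 1 this ultraW uK uL] comm show False by simp
  next
    case 2
    have "|M| \<le>o |L|" if "|M| <o |K|" for M :: "'b set set"
      using GCH_columns[OF gch(2) infL[unfolded L_def]] that unfolding K_def L_def by simp
    from not_commute_if_uniform[OF bot(2,1) infL 2 this ultraU uL uK] comm show False by simp
  qed
qed

section \<open>Ultrafilters and tensor products\<close>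

lemma ultrafilter_on_cases:
  assumes "ultrafilter_on X U"
  shows "(\<forall>\<^sub>F x in U. P x) \<or> (\<forall>\<^sub>F x in U. \<not> P x)"
proof -
  have "(\<forall>\<^sub>F x in U. x \<in> {x \<in> X. P x}) \<or> (\<forall>\<^sub>F x in U. x \<in> X - {x \<in> X. P x})"
    by (rule assms[unfolded ultrafilter_on_def, THEN conjunct2, THEN conjunct2, rule_format]) simp
  then show ?thesis
    by (rule disj_forward) (erule eventually_mono, simp)+
qed

text \<open>A predicate not in \<open>U\<close> has its negation in \<open>U\<close>, hence in
  \<open>F\<close>, so it cannot be in the proper filter \<open>F\<close>. Both tensor products
  refine the product filter, so they coincide with it once it is an ultrafilter.\<close>

lemma ultrafilter_on_minimal:
  assumes "ultrafilter_on X U" and "F \<le> U" and "F \<noteq> bot"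
  shows "F = U"
proof (rule antisym[OF assms(2)], rule filter_leI)
  fix P assume P: "eventually P F"
  show "eventually P U"
  proof (rule ccontr)
    assume "\<not> ?thesis"
    then have "\<forall>\<^sub>F x in U. \<not> P x" using ultrafilter_on_cases[OF assms(1), of P] by simp
    with assms(2) have "\<forall>\<^sub>F x in F. \<not> P x" by (rule filter_leD)
    with P have "\<forall>\<^sub>F x in F. False" by eventually_elim simp
    then show False using assms(3) by (simp add: eventually_False)
  qed
qed

lemma left_tensor_le_prod_filter: "left_tensor F G \<le> F \<times>\<^sub>F G"
  by (rule filter_leI) (auto simp: eventually_left_tensor eventually_prod_filter elim!: eventually_mono)

lemma right_tensor_le_prod_filter: "right_tensor F G \<le> F \<times>\<^sub>F G"
  by (rule filter_leI) (auto simp: eventually_right_tensor eventually_prod_filter elim!: eventually_mono)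

lemma left_tensor_eq_bot_iff: "left_tensor F G = bot \<longleftrightarrow> F = bot \<or> G = bot"
  by (simp only: eventually_left_tensor flip: eventually_False) (auto simp: eventually_const_iff eventually_False)

lemma right_tensor_eq_bot_iff: "right_tensor F G = bot \<longleftrightarrow> F = bot \<or> G = bot"
  by (simp only: eventually_right_tensor flip: eventually_False) (auto simp: eventually_const_iff eventually_False)

theorem theorem1p7:
  fixes X :: "'a set" and Y :: "'b set"
    and U :: "'a filter" and W :: "'b filter"
  assumes "GCH TYPE('a)" and "GCH TYPE('b)"
    and "ultrafilter_on X U" and "ultrafilter_on Y W"
  shows "left_tensor U W = right_tensor U W \<longleftrightarrow> ultrafilter_on (X \<times> Y) (U \<times>\<^sub>F W)"
proof
  have bot: "U \<noteq> bot" "W \<noteq> bot" using assms(3,4) by (auto simp: ultrafilter_on_def)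
  {
    assume eq: "left_tensor U W = right_tensor U W"
    have comm: "(\<forall>\<^sub>F x in U. \<forall>\<^sub>F y in W. P x y) \<longleftrightarrow> (\<forall>\<^sub>F y in W. \<forall>\<^sub>F x in U. P x y)" for P
      using arg_cong[OF eq, of "eventually (\<lambda>(x, y). P x y)"]
      by (simp add: eventually_left_tensor eventually_right_tensor)
    have le: "U \<times>\<^sub>F W \<le> principal (X \<times> Y)"
      using prod_filter_mono[of U "principal X" W "principal Y"] assms(3,4)
      by (simp add: ultrafilter_on_def principal_prod_principal)
    then have XY: "\<forall>\<^sub>F z in U \<times>\<^sub>F W. z \<in> X \<times> Y" by (simp add: le_principal)
    have "(\<forall>\<^sub>F z in U \<times>\<^sub>F W. z \<in> R) \<or> (\<forall>\<^sub>F z in U \<times>\<^sub>F W. z \<in> X \<times> Y - R)" for R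
      using prod_filter_decides_if_commute[OF assms(1,2) ultrafilter_on_cases[OF assms(3)]
          ultrafilter_on_cases[OF assms(4)] bot comm, of "\<lambda>x y. (x, y) \<in> R"] XY
      by (simp add: case_prod_unfold eventually_conj_iff)
    with le bot show "ultrafilter_on (X \<times> Y) (U \<times>\<^sub>F W)"
      by (simp add: ultrafilter_on_def prod_filter_eq_bot)
  next
    assume ult: "ultrafilter_on (X \<times> Y) (U \<times>\<^sub>F W)"
    have "left_tensor U W = U \<times>\<^sub>F W"
      by (rule ultrafilter_on_minimal[OF ult left_tensor_le_prod_filter])
        (simp add: left_tensor_eq_bot_iff bot)
    moreover have "right_tensor U W = U \<times>\<^sub>F W"
      by (rule ultrafilter_on_minimal[OF ult right_tensor_le_prod_filter])
        (simp add: right_tensor_eq_bot_iff bot)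
    ultimately show "left_tensor U W = right_tensor U W" by simp
  }
qed

end
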